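(* Let $n\geq3$ and let $\mathcal{E}=\{N\in\mathbb{C}^{n\times n}:NN^*=N^*N\}$ be the set of complex normal matrices. If $A\in\mathbb{R}^{n\times n}$ is sampled uniformly from the unit sphere $\{A\in\mathbb{R}^{n\times n}:\|A\|_F=1\}$, then $$0<\mathbb{P}\bigl(d_{\mathbb{R}}(A)=d_{\mathbb{C}}(A)\bigr)<1.$$
   Context: $\|\cdot\|_F$ is the Frobenius norm. For $A\in\mathbb{R}^{n\times n}$, $d_{\mathbb{C}}(A)=\min_{X\in\mathcal{E}}\|A-X\|_F$ and $d_{\mathbb{R}}(A)=\min_{X\in\mathcal{E}\cap\mathbb{R}^{n\times n}}\|A-X\|_F$. The event $d_{\mathbb{R}}(A)=d_{\mathbb{C}}(A)$ is the event that $A$ has a real nearest matrix in $\mathcal{E}$. *)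

theory Defs
  imports "HOL-Probability.Probability"
begin

text \<open>
  The library norm on matrices \<^typ>\<open>'a ^ 'n ^ 'm\<close> (an iterated L2 norm) is the Frobenius norm,
  and \<^const>\<open>dist\<close> and \<^const>\<open>infdist\<close> on matrices are taken with respect to it.
\<close>

lemma norm_eq_frobenius:
  fixes A :: "'a::real_normed_vector ^ 'n ^ 'm"
  shows "norm A = sqrt (\<Sum>i\<in>UNIV. \<Sum>j\<in>UNIV. (norm (A $ i $ j))\<^sup>2)"
  by (simp add: norm_vec_def L2_set_def sum_nonneg)

definition conj_transpose :: "complex ^ 'n ^ 'm \<Rightarrow> complex ^ 'm ^ 'n" where
  "conj_transpose A = map_matrix cnj (transpose A)"

definition normal_matrices :: "(complex ^ 'n ^ 'n) set" where
  "normal_matrices = {N. N ** conj_transpose N = conj_transpose N ** N}"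

definition real_matrices :: "(complex ^ 'n ^ 'n) set" where
  "real_matrices = range (map_matrix complex_of_real)"

definition d_complex :: "real ^ 'n ^ 'n \<Rightarrow> real" where
  "d_complex A = infdist (map_matrix complex_of_real A) normal_matrices"

definition d_real :: "real ^ 'n ^ 'n \<Rightarrow> real" where
  "d_real A = infdist (map_matrix complex_of_real A) (normal_matrices \<inter> real_matrices)"

lemma closed_normal_matrices: "closed (normal_matrices :: (complex ^ 'n ^ 'n) set)"
  unfolding normal_matrices_def conj_transpose_def map_matrix_def matrix_matrix_mult_def transpose_def
  by (intro closed_Collect_eq continuous_intros)

lemma real_matrices_alt: "real_matrices = {X. \<forall>i j. X $ i $ j \<in> \<real>}"
proof -
  have "X \<in> range (map_matrix complex_of_real)"
    if "\<forall>i j. X $ i $ j \<in> \<real>" for X :: "complex ^ 'n ^ 'n"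
  proof
    show "X = map_matrix complex_of_real (map_matrix Re X)"
      using that by (simp add: vec_eq_iff)
  qed simp
  then show ?thesis
    by (auto simp: real_matrices_def)
qed

lemma closed_real_matrices: "closed (real_matrices :: (complex ^ 'n ^ 'n) set)"
  unfolding real_matrices_alt
  using closed_vimage_vec_nth[OF closed_vimage_vec_nth[OF closed_complex_Reals]]
  by (intro closed_Collect_all) (simp add: vimage_def)

lemma zero_in_normal_real: "0 \<in> normal_matrices \<inter> real_matrices"
  by (simp add: normal_matrices_def real_matrices_alt conj_transpose_def
      map_matrix_def matrix_matrix_mult_def transpose_def vec_eq_iff)

text \<open>The infima defining the two distances are attained, i.e. they are minima.\<close>

lemma infdist_is_minimum:
  fixes S :: "'a::heine_borel set"
  assumes "closed S" "S \<noteq> {}"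
  shows "(\<exists>X\<in>S. infdist a S = dist a X) \<and> (\<forall>X\<in>S. infdist a S \<le> dist a X)"
  using infdist_attains_inf[OF assms] by (metis infdist_le)

lemma d_complex_minimum:
  "(\<exists>X\<in>normal_matrices. d_complex A = norm (map_matrix complex_of_real A - X)) \<and>
   (\<forall>X\<in>normal_matrices. d_complex A \<le> norm (map_matrix complex_of_real A - X))"
  unfolding d_complex_def dist_norm[symmetric]
  using zero_in_normal_real by (intro infdist_is_minimum closed_normal_matrices) auto

lemma d_real_minimum:
  "(\<exists>X\<in>normal_matrices \<inter> real_matrices. d_real A = norm (map_matrix complex_of_real A - X)) \<and>
   (\<forall>X\<in>normal_matrices \<inter> real_matrices. d_real A \<le> norm (map_matrix complex_of_real A - X))"
  unfolding d_real_def dist_norm[symmetric]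
  using zero_in_normal_real
  by (intro infdist_is_minimum closed_Int closed_normal_matrices closed_real_matrices) blast+

lemma d_real_eq_d_complex_iff:
  "d_real A = d_complex A \<longleftrightarrow>
    (\<exists>X\<in>normal_matrices \<inter> real_matrices. norm (map_matrix complex_of_real A - X) = d_complex A)"
  using d_complex_minimum[of A] d_real_minimum[of A] by (metis IntE order_antisym)

text \<open>
  The uniform distribution on the unit sphere: the radial projection of the uniform distribution
  on the unit ball.  The centre, which is mapped to 0, is a null set.  The lemmas below
  show that this is the rotation invariant Borel probability measure on the sphere.
\<close>

definition uniform_unit_sphere :: "'a::euclidean_space measure" where
  "uniform_unit_sphere = distr (uniform_measure lborel (ball 0 1)) borel (\<lambda>x. x /\<^sub>R norm x)"

lemma space_uniform_unit_sphere [simp]: "space uniform_unit_sphere = UNIV"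
  and sets_uniform_unit_sphere [simp, measurable_cong]: "sets uniform_unit_sphere = sets borel"
  by (simp_all add: uniform_unit_sphere_def)

lemma unit_ball_measure:
  "emeasure lborel (ball (0::'a::euclidean_space) 1) \<noteq> 0"
  "emeasure lborel (ball (0::'a::euclidean_space) 1) \<noteq> \<infinity>"
proof -
  show "emeasure lborel (ball (0::'a) 1) \<noteq> \<infinity>"
    using emeasure_bounded_finite[OF bounded_ball, of "0::'a" 1] by simp
  show "emeasure lborel (ball (0::'a) 1) \<noteq> 0"
    using content_ball_pos[of 1 "0::'a"] by (auto simp: measure_def)
qed

lemma prob_space_uniform_unit_sphere:
  "prob_space (uniform_unit_sphere :: 'a::euclidean_space measure)"
  unfolding uniform_unit_sphere_def
  by (intro prob_space.prob_space_distr prob_space_uniform_measure unit_ball_measure) measurable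

lemma AE_uniform_unit_sphere:
  "AE x in (uniform_unit_sphere :: 'a::euclidean_space measure). x \<in> sphere 0 1"
proof -
  have "AE x in lborel. (x::'a) \<noteq> 0"
    by (rule AE_lborel_singleton)
  then have "AE x in uniform_measure lborel (ball (0::'a) 1). norm (x /\<^sub>R norm x) = 1"
    by (intro AE_uniform_measureI) (auto elim!: eventually_mono)
  then show ?thesis
    unfolding uniform_unit_sphere_def by (subst AE_distr_iff) auto
qed

lemma lborel_distr_orthogonal:
  fixes f :: "'a::euclidean_space \<Rightarrow> 'a"
  assumes "orthogonal_transformation f"
  shows "distr lborel borel f = lborel"
proof (rule measure_eqI)
  let ?N = "distr lborel borel f"
  let ?B = "ball (0::'a) 1"
  have lin: "linear f" and nf: "\<And>x. norm (f x) = norm x"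
    using assms by (auto simp: orthogonal_transformation)
  have [measurable]: "f \<in> borel_measurable borel"
    using lin by (intro borel_measurable_continuous_onI linear_continuous_on)
      (simp add: linear_conv_bounded_linear)
  have surj: "surj f"
    using assms by (rule orthogonal_transformation_surj)
  have inv: "distr lborel borel ((+) x) = (lborel :: 'a measure)" for x
    by (rule lborel_distr_plus)
  have Ninv: "distr ?N borel ((+) x) = ?N" for x
  proof -
    obtain z where z: "x = f z" using surj by (metis surjD)
    have "distr ?N borel ((+) x) = distr lborel borel (\<lambda>y. f (z + y))"
      by (subst distr_distr) (auto simp: o_def z linear_add[OF lin])
    also have "\<dots> = distr (distr lborel borel ((+) z)) borel f"
      by (subst distr_distr) (auto simp: o_def)
    finally show ?thesis by (simp add: inv)
  qed
  have [measurable]: "?B \<in> sets borel" by simp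
  have NB: "emeasure ?N ?B = emeasure lborel ?B"
    by (subst emeasure_distr) (auto simp: nf vimage_def ball_def)
  interpret N: sigma_finite_measure ?N
  proof
    let ?C = "range (\<lambda>n::nat. ball (0::'a) (real n))"
    have "f -` ball 0 r = ball 0 r" for r
      by (auto simp: nf)
    then show "\<exists>A. countable A \<and> A \<subseteq> sets ?N \<and> \<Union>A = space ?N \<and> (\<forall>a\<in>A. emeasure ?N a \<noteq> \<infinity>)"
      using emeasure_bounded_finite[OF bounded_ball, of "0::'a"]
      by (intro exI[of _ ?C]) (auto simp: emeasure_distr less_top reals_Archimedean2)
  qed
  interpret P: pair_sigma_finite "lborel :: 'a measure" ?N ..
  fix A assume "A \<in> sets ?N"
  then have [measurable]: "A \<in> sets borel" by simp
  have "emeasure lborel A * emeasure lborel ?B =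
      (\<integral>\<^sup>+y. emeasure lborel A * indicator ?B y \<partial>?N)"
    by (simp add: nn_integral_cmult_indicator NB)
  also have "\<dots> = (\<integral>\<^sup>+y. (\<integral>\<^sup>+x. indicator A x * indicator ?B y \<partial>lborel) \<partial>?N)"
    by (simp add: nn_integral_multc)
  also have "\<dots> = (\<integral>\<^sup>+y. (\<integral>\<^sup>+x. indicator A (y + x) * indicator ?B y \<partial>lborel) \<partial>?N)"
  proof (rule nn_integral_cong)
    fix y
    have "(\<integral>\<^sup>+x. indicator A x * indicator ?B y \<partial>lborel) =
       (\<integral>\<^sup>+x. indicator A x * indicator ?B y \<partial>distr lborel borel ((+) y))"
      by (simp add: inv)
    also have "\<dots> = (\<integral>\<^sup>+x. indicator A (y + x) * indicator ?B y \<partial>lborel)"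
      by (subst nn_integral_distr) auto
    finally show "(\<integral>\<^sup>+x. indicator A x * indicator ?B y \<partial>lborel) =
       (\<integral>\<^sup>+x. indicator A (y + x) * indicator ?B y \<partial>lborel)" .
  qed
  also have "\<dots> = (\<integral>\<^sup>+x. (\<integral>\<^sup>+y. indicator A (y + x) * indicator ?B y \<partial>?N) \<partial>lborel)"
    by (rule P.Fubini') measurable
  also have "\<dots> = (\<integral>\<^sup>+x. (\<integral>\<^sup>+y. indicator A y * indicator ?B (y - x) \<partial>?N) \<partial>lborel)"
  proof (rule nn_integral_cong)
    fix x
    have "(\<integral>\<^sup>+y. indicator A (y + x) * indicator ?B y \<partial>?N) =
       (\<integral>\<^sup>+y. indicator A y * indicator ?B (y - x) \<partial>distr ?N borel ((+) x))"
      by (subst nn_integral_distr) (auto simp: add.commute)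
    then show "(\<integral>\<^sup>+y. indicator A (y + x) * indicator ?B y \<partial>?N) =
       (\<integral>\<^sup>+y. indicator A y * indicator ?B (y - x) \<partial>?N)"
      by (simp only: Ninv)
  qed
  also have "\<dots> = (\<integral>\<^sup>+y. (\<integral>\<^sup>+x. indicator A y * indicator ?B (y - x) \<partial>lborel) \<partial>?N)"
    by (rule P.Fubini'[symmetric]) measurable
  also have "\<dots> = (\<integral>\<^sup>+y. indicator A y * emeasure lborel ?B \<partial>?N)"
  proof (rule nn_integral_cong)
    fix y :: 'a
    have "(\<integral>\<^sup>+x. indicator A y * indicator ?B (y - x) \<partial>lborel) =
        (\<integral>\<^sup>+x. indicator A y * indicator (ball y 1) x \<partial>lborel)"
      by (intro nn_integral_cong) (auto simp: indicator_def dist_norm norm_minus_commute)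
    also have "\<dots> = indicator A y * emeasure lborel (ball y 1)"
      by (simp add: nn_integral_cmult_indicator)
    also have "emeasure lborel (ball y 1) = emeasure lborel ?B"
    proof -
      have "emeasure lborel ?B = emeasure (distr lborel borel ((+) (-y))) ?B"
        by (simp add: inv)
      also have "\<dots> = emeasure lborel (ball y 1)"
        by (subst emeasure_distr) (auto simp: vimage_def ball_def dist_norm norm_minus_commute)
      finally show ?thesis by simp
    qed
    finally show "(\<integral>\<^sup>+x. indicator A y * indicator ?B (y - x) \<partial>lborel) =
        indicator A y * emeasure lborel ?B" .
  qed
  also have "\<dots> = emeasure ?N A * emeasure lborel ?B"
    by (simp add: nn_integral_multc)
  finally show "emeasure ?N A = emeasure lborel A"
    using unit_ball_measure[where 'a='a]
    by (metis ennreal_mult_cancel_left mult.commute infinity_ennreal_def)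
qed simp

lemma uniform_unit_sphere_rotation_invariant:
  fixes f :: "'a::euclidean_space \<Rightarrow> 'a"
  assumes "orthogonal_transformation f"
  shows "distr uniform_unit_sphere borel f = uniform_unit_sphere"
proof -
  let ?U = "uniform_measure lborel (ball (0::'a) 1)"
  have lin: "linear f" and nf: "\<And>x. norm (f x) = norm x"
    using assms by (auto simp: orthogonal_transformation)
  have [measurable]: "f \<in> borel_measurable borel"
    using lin by (intro borel_measurable_continuous_onI linear_continuous_on)
      (simp add: linear_conv_bounded_linear)
  have U: "distr ?U borel f = ?U"
  proof (rule measure_eqI)
    fix A assume "A \<in> sets (distr ?U borel f)"
    then have [measurable]: "A \<in> sets borel" by simp
    have "emeasure (distr ?U borel f) A = emeasure ?U (f -` A)"
      by (subst emeasure_distr) simp_all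
    also have "\<dots> = emeasure lborel (ball 0 1 \<inter> f -` A) / emeasure lborel (ball (0::'a) 1)"
      using measurable_sets_borel[of f borel A] by (intro emeasure_uniform_measure) simp_all
    also have "ball 0 1 \<inter> f -` A = f -` (ball 0 1 \<inter> A)"
      by (auto simp: nf)
    also have "emeasure lborel (f -` (ball 0 1 \<inter> A)) = emeasure (distr lborel borel f) (ball 0 1 \<inter> A)"
      by (subst emeasure_distr) auto
    finally show "emeasure (distr ?U borel f) A = emeasure ?U A"
      by (simp add: lborel_distr_orthogonal[OF assms])
  qed simp
  have "distr uniform_unit_sphere borel f = distr ?U borel (\<lambda>x. f x /\<^sub>R norm (f x))"
    unfolding uniform_unit_sphere_def
    by (subst distr_distr) (auto simp: o_def nf linear_cmul[OF lin])
  also have "\<dots> = distr (distr ?U borel f) borel (\<lambda>x. x /\<^sub>R norm x)"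
    by (subst distr_distr) (auto simp: o_def)
  finally show ?thesis
    by (simp add: U uniform_unit_sphere_def)
qed

end

theory Submission
  imports Defs
begin

text \<open>
  Write a real matrix as \<open>A = S + K\<close> with \<open>S\<close> symmetric and \<open>K\<close> skew.  The symmetric part is
  a real normal matrix at distance \<open>\<parallel>K\<parallel>\<close>.  Near a diagonal matrix with distinct entries nothing
  does better: a normal \<open>X = P + i Q\<close> satisfies \<open>[P\<^sub>s, P\<^sub>k] = [Q\<^sub>k, Q\<^sub>s]\<close> for the symmetric and skew
  parts, so \<open>[S, P\<^sub>k] = [S - P\<^sub>s, P\<^sub>k] + [Q\<^sub>k, Q\<^sub>s]\<close>, and since \<open>[S, \<cdot>]\<close> is bounded below on skew
  matrices, \<open>P\<^sub>k\<close> is of second order and cannot pay for the error made in \<open>S\<close>.  This gives an open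
  set on which the two distances agree.

  Conversely, the \<open>3 \<times> 3\<close> matrix with rows \<open>(0, 3, 0)\<close>, \<open>(3, 0, -2)\<close>, \<open>(0, 2, 0)\<close> has squared real
  distance 8 (a non-symmetric real normal matrix commutes with a rotation about some axis, hence has
  symmetric part \<open>\<alpha> I + \<beta> r r\<^sup>T\<close>), but a complex normal matrix at squared distance 7.64.
  Taking the direct sum with \<open>k I\<close> for large \<open>k\<close> transfers the strict inequality to every larger
  size, and by continuity it holds on an open set.
\<close>

section \<open>Open cones and the uniform distribution on the sphere\<close>

lemma emeasure_lborel_open_pos:
  fixes U :: "'a::euclidean_space set"
  assumes "open U" "U \<noteq> {}"
  shows "emeasure lborel U > 0"
proof -
  obtain x e where e: "e > 0" "ball x e \<subseteq> U"
    using assms by (meson all_not_in_conv open_contains_ball)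
  have "0 < emeasure lborel (ball x e)"
    using content_ball_pos[of e x] e by (auto simp: measure_def zero_less_iff_neq_zero)
  also have "\<dots> \<le> emeasure lborel U"
    using e assms by (intro emeasure_mono) auto
  finally show ?thesis .
qed

text \<open>Radial projection ignores positive scaling. So it maps into \<open>E\<close> the part of
  a small multiple of \<open>U\<close> that lies in the unit ball, less the origin; that part is
  open and nonempty, hence of positive volume.\<close>

lemma measure_uniform_unit_sphere_pos:
  fixes U :: "'a::euclidean_space set"
  assumes U: "open U" "U \<noteq> {}" and E [measurable]: "E \<in> sets borel"
    and UE: "\<And>x. x \<in> U \<Longrightarrow> x \<noteq> 0 \<Longrightarrow> x /\<^sub>R norm x \<in> E"
  shows "measure uniform_unit_sphere E > 0"
proof -
  interpret S: prob_space "uniform_unit_sphere :: 'a measure"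
    by (rule prob_space_uniform_unit_sphere)
  obtain x0 where x0: "x0 \<in> U" using U by auto
  \<comment> \<open>This factor brings the chosen point \<open>x0\<close> of \<open>U\<close> into
    the open unit ball.\<close>
  define t where "t = 1 / (norm x0 + 1)"
  have t: "t > 0" by (simp add: t_def add_nonneg_pos)
  have "norm (t *\<^sub>R x0) < 1"
    by (simp add: t_def divide_less_eq add_nonneg_pos)
  then have tx0: "t *\<^sub>R x0 \<in> (\<lambda>x. t *\<^sub>R x) ` U \<inter> ball 0 1"
    using x0 by auto
  define V where "V = (\<lambda>x. t *\<^sub>R x) ` U \<inter> ball 0 1 - {0}"
  have V: "open V" using U t by (auto simp: V_def intro!: open_scaling)
  \<comment> \<open>The scaled piece is open and \<open>{0}\<close> is not, so a point remains after
    the origin is removed.\<close>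
  have "(\<lambda>x. t *\<^sub>R x) ` U \<inter> ball 0 1 \<noteq> {0}"
    using U t not_open_singleton[of "0::'a"] open_scaling[of t U] by (metis less_irrefl open_Int open_ball)
  then have "V \<noteq> {}" using tx0 by (auto simp: V_def)
  then have Vpos: "emeasure lborel V > 0"
    using V by (intro emeasure_lborel_open_pos)
  have VE: "x /\<^sub>R norm x \<in> E" if "x \<in> V" for x
  proof -
    obtain y where y: "y \<in> U" "x = t *\<^sub>R y"
      using \<open>x \<in> V\<close> unfolding V_def by blast
    moreover have "y \<noteq> 0" using \<open>x \<in> V\<close> y unfolding V_def by auto
    moreover have "x /\<^sub>R norm x = y /\<^sub>R norm y" using t y by simp
    ultimately show ?thesis using UE by metis
  qed
  let ?B = "ball (0::'a) 1" and ?f = "\<lambda>x::'a. x /\<^sub>R norm x"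
  have "V \<subseteq> ?B \<inter> (?f -` E)"
    using VE by (auto simp only: V_def)
  then have "emeasure lborel V / emeasure lborel ?B \<le> emeasure lborel (?B \<inter> (?f -` E)) / emeasure lborel ?B"
    using measurable_sets_borel[of ?f borel E]
    by (intro divide_right_mono_ennreal emeasure_mono) auto
  moreover have "0 < emeasure lborel V / emeasure lborel ?B"
    using Vpos unit_ball_measure[where 'a='a] by (auto simp: ennreal_zero_less_divide less_top)
  ultimately have "0 < emeasure lborel (?B \<inter> (?f -` E)) / emeasure lborel ?B"
    by (rule less_le_trans [rotated])
  also have "\<dots> = emeasure (uniform_measure lborel ?B) (?f -` E)"
    using measurable_sets_borel[of ?f borel E] by (intro emeasure_uniform_measure [symmetric]) auto
  also have "\<dots> = emeasure uniform_unit_sphere E"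
    unfolding uniform_unit_sphere_def by (subst emeasure_distr) auto
  finally show ?thesis
    by (simp add: S.emeasure_eq_measure)
qed

section \<open>Homogeneity and continuity of the two distances\<close>

lemma infdist_scaleR:
  fixes S :: "'a::real_normed_vector set"
  assumes "c > 0" and S: "\<And>c x. c > 0 \<Longrightarrow> x \<in> S \<Longrightarrow> c *\<^sub>R x \<in> S"
  shows "infdist (c *\<^sub>R a) S = c * infdist a S"
proof (cases "S = {}")
  case True
  then show ?thesis by (simp add: infdist_def)
next
  case False
  have le: "infdist (c *\<^sub>R a) S \<le> c * infdist a S" if "c > 0" for c a
  proof -
    have "infdist (c *\<^sub>R a) S / c \<le> dist a x" if "x \<in> S" for x
    proof -
      have "infdist (c *\<^sub>R a) S \<le> dist (c *\<^sub>R a) (c *\<^sub>R x)"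
        using S \<open>c > 0\<close> that by (intro infdist_le) auto
      also have "\<dots> = c * dist a x" using \<open>c > 0\<close>
        by (simp add: dist_norm flip: scaleR_diff_right)
      finally show ?thesis using \<open>c > 0\<close> by (simp add: divide_le_eq mult.commute)
    qed
    then have "infdist (c *\<^sub>R a) S / c \<le> infdist a S"
      using False by (simp add: infdist_notempty cINF_greatest)
    then show ?thesis using \<open>c > 0\<close> by (simp add: divide_le_eq mult.commute)
  qed
  \<comment> \<open>The reverse inequality is \<open>le\<close> for the factor
    \<open>inverse c\<close>.\<close>
  have "infdist a S \<le> inverse c * infdist (c *\<^sub>R a) S"
    using le[of "inverse c" "c *\<^sub>R a"] \<open>c > 0\<close> by simp
  then show ?thesis using le[of c a] \<open>c > 0\<close>
    by (simp add: field_simps)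
qed

lemma map_matrix_of_real_scaleR:
  "map_matrix complex_of_real (c *\<^sub>R A) = c *\<^sub>R map_matrix complex_of_real A"
  unfolding vec_eq_iff by (simp, simp add: scaleR_conv_of_real)

lemma normal_matrices_scaleR:
  fixes X :: "complex ^ 'n ^ 'n"
  assumes "X \<in> normal_matrices" shows "c *\<^sub>R X \<in> normal_matrices"
proof -
  have "conj_transpose (c *\<^sub>R X) = c *\<^sub>R conj_transpose X"
    by (simp add: conj_transpose_def transpose_def vec_eq_iff)
  moreover have "c *\<^sub>R X ** c *\<^sub>R Y = (c * c) *\<^sub>R (X ** Y)" for X Y :: "complex ^ 'n ^ 'n"
    by (simp add: matrix_matrix_mult_def vec_eq_iff scaleR_sum_right)
  ultimately show ?thesis using assms by (simp add: normal_matrices_def)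
qed

lemma real_matrices_scaleR: "X \<in> real_matrices \<Longrightarrow> c *\<^sub>R X \<in> real_matrices"
  unfolding real_matrices_alt by (auto simp: complex_is_Real_iff)

text \<open>Both sets of matrices are cones, so equality or strict inequality of the distances
  passes from a nonzero matrix to its projection on the sphere.\<close>

lemma d_scaleR:
  assumes "c > 0"
  shows "d_complex (c *\<^sub>R A) = c * d_complex A" "d_real (c *\<^sub>R A) = c * d_real A"
  unfolding d_complex_def d_real_def map_matrix_of_real_scaleR
  by (intro infdist_scaleR assms; auto intro: normal_matrices_scaleR real_matrices_scaleR)+

lemma norm_map_matrix_of_real: "norm (map_matrix complex_of_real A) = norm A"
  by (simp add: norm_eq_frobenius)

lemma map_matrix_of_real_diff:
  "map_matrix complex_of_real A - map_matrix complex_of_real B = map_matrix complex_of_real (A - B)"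
  by (simp add: vec_eq_iff)

lemma continuous_on_d:
  shows "continuous_on UNIV (d_complex :: real^'n^'n \<Rightarrow> real)" "continuous_on UNIV (d_real :: real^'n^'n \<Rightarrow> real)"
proof -
  have "continuous_on UNIV (\<lambda>A::real^'n^'n. map_matrix complex_of_real A)"
    unfolding map_matrix_def by (intro continuous_intros)
  then show "continuous_on UNIV (d_complex :: real^'n^'n \<Rightarrow> real)" "continuous_on UNIV (d_real :: real^'n^'n \<Rightarrow> real)"
    unfolding d_complex_def d_real_def by (auto intro!: continuous_on_infdist)
qed

section \<open>Perturbations of diagonal matrices\<close>

lemma transpose_add: "transpose (A + B) = transpose A + transpose (B :: 'a::plus ^ 'n ^ 'm)"
  by (simp add: transpose_def vec_eq_iff)

lemma transpose_diff: "transpose (A - B) = transpose A - transpose (B :: 'a::minus ^ 'n ^ 'm)"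
  by (simp add: transpose_def vec_eq_iff)

lemma norm_transpose: "norm (transpose A) = norm (A :: real ^ 'n ^ 'm)"
  unfolding norm_eq_frobenius transpose_def by (subst sum.swap) simp

lemma inner_transpose: "transpose A \<bullet> transpose B = A \<bullet> (B :: real ^ 'n ^ 'm)"
  unfolding inner_vec_def transpose_def by (subst sum.swap) simp

text \<open>Each entry is the inner product of a row of \<open>A\<close> and a column of
  \<open>B\<close>; after Cauchy-Schwarz the double sum of squares factors.\<close>

lemma norm_matrix_mult_le: "norm (A ** B) \<le> norm A * norm (B :: real ^ 'n ^ 'k)" for A :: "real ^ 'k ^ 'm"
proof -
  have "norm (A ** B) \<le> sqrt (\<Sum>i\<in>UNIV. \<Sum>j\<in>UNIV. (norm (A $ i) * norm (transpose B $ j))\<^sup>2)"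
  proof -
    have "\<bar>(A ** B) $ i $ j\<bar> \<le> norm (A $ i) * norm (transpose B $ j)" for i j
      using Cauchy_Schwarz_ineq2 [of "A $ i" "transpose B $ j"]
      by (simp add: inner_vec_def transpose_def matrix_matrix_mult_def)
    then show ?thesis
      unfolding norm_eq_frobenius
      by (intro real_sqrt_le_mono sum_mono power_mono) auto
  qed
  also have "\<dots> = sqrt ((\<Sum>i\<in>UNIV. (norm (A $ i))\<^sup>2) * (\<Sum>j\<in>UNIV. (norm (transpose B $ j))\<^sup>2))"
    by (simp add: power_mult_distrib sum_product)
  also have "\<dots> = norm A * norm (transpose B)"
    by (simp add: norm_vec_def L2_set_def real_sqrt_mult)
  finally show ?thesis by (simp add: norm_transpose)
qed

definition commutator :: "real ^ 'n ^ 'n \<Rightarrow> real ^ 'n ^ 'n \<Rightarrow> real ^ 'n ^ 'n" where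
  "commutator A B = A ** B - B ** A"

lemma matrix_diff_ldistrib: "A ** (B - C) = A ** B - A ** C" for A B C :: "real ^ 'n ^ 'n"
  by (simp add: matrix_matrix_mult_def vec_eq_iff sum_subtractf algebra_simps)

lemma matrix_diff_rdistrib: "(B - C) ** A = B ** A - C ** A" for A B C :: "real ^ 'n ^ 'n"
  by (simp add: matrix_matrix_mult_def vec_eq_iff sum_subtractf algebra_simps)

lemma matrix_add_rdistrib: "(B + C) ** A = B ** A + C ** A" for A B C :: "real ^ 'n ^ 'n"
  by (simp add: matrix_matrix_mult_def vec_eq_iff sum.distrib algebra_simps)

lemma commutator_add_left: "commutator (A + B) C = commutator A C + commutator B C"
  by (simp add: commutator_def matrix_add_ldistrib matrix_add_rdistrib)

lemma norm_commutator_le: "norm (commutator A B) \<le> 2 * norm A * norm B"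
proof -
  have "norm (commutator A B) \<le> norm (A ** B) + norm (B ** A)"
    unfolding commutator_def by (rule norm_triangle_ineq4)
  also have "\<dots> \<le> norm A * norm B + norm B * norm A"
    by (intro add_mono norm_matrix_mult_le)
  also have "\<dots> = 2 * norm A * norm B"
    by simp
  finally show ?thesis .
qed

section \<open>Symmetric and skew parts\<close>

definition sym_part :: "real ^ 'n ^ 'n \<Rightarrow> real ^ 'n ^ 'n" where
  "sym_part A = (1/2) *\<^sub>R (A + transpose A)"

definition skew_part :: "real ^ 'n ^ 'n \<Rightarrow> real ^ 'n ^ 'n" where
  "skew_part A = (1/2) *\<^sub>R (A - transpose A)"

lemma transpose_sym_part: "transpose (sym_part A) = sym_part A"
  by (simp add: sym_part_def transpose_scalar transpose_add add.commute)

lemma transpose_skew_part: "transpose (skew_part A) = - skew_part A"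
  by (simp add: skew_part_def transpose_scalar transpose_diff flip: scaleR_minus_right)

lemma sym_part_add_skew_part: "sym_part A + skew_part A = A"
  by (simp add: sym_part_def skew_part_def vec_eq_iff field_simps)

lemma sym_part_diff_skew_part: "sym_part A - skew_part A = transpose A"
  by (simp add: sym_part_def skew_part_def vec_eq_iff field_simps)

lemma sym_part_diff: "sym_part (A - B) = sym_part A - sym_part B"
  by (simp add: sym_part_def transpose_diff vec_eq_iff field_simps)

lemma skew_part_diff: "skew_part (A - B) = skew_part A - skew_part B"
  by (simp add: skew_part_def transpose_diff vec_eq_iff field_simps)

text \<open>Transposition preserves inner products but flips the sign of the one between the two
  parts, so they are orthogonal.\<close>

lemma norm_sym_skew: "(norm A)\<^sup>2 = (norm (sym_part A))\<^sup>2 + (norm (skew_part A))\<^sup>2"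
proof -
  have "sym_part A \<bullet> skew_part A = - (sym_part A \<bullet> skew_part A)"
    using inner_transpose [of "sym_part A" "skew_part A"]
    by (simp add: transpose_sym_part transpose_skew_part)
  then have "sym_part A \<bullet> skew_part A = 0" by simp
  moreover have "(norm A)\<^sup>2 = (norm (sym_part A + skew_part A))\<^sup>2"
    by (simp add: sym_part_add_skew_part)
  ultimately show ?thesis
    by (simp add: power2_norm_eq_inner inner_add_left inner_add_right inner_commute)
qed

lemma norm_sym_part_le: "norm (sym_part A) \<le> norm A" and norm_skew_part_le: "norm (skew_part A) \<le> norm A"
  by (rule power2_le_imp_le; simp add: norm_sym_skew [of A])+

lemma norm_power2_frobenius:
  "(norm A)\<^sup>2 = (\<Sum>i\<in>UNIV. \<Sum>j\<in>UNIV. (norm (A $ i $ j))\<^sup>2)"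
  for A :: "'a::real_normed_vector ^ 'n ^ 'm"
  unfolding norm_eq_frobenius by (intro real_sqrt_pow2 sum_nonneg) simp

lemma norm_complex_matrix_split:
  "(norm (map_matrix complex_of_real A - X))\<^sup>2
    = (norm (A - map_matrix Re X))\<^sup>2 + (norm (map_matrix Im X))\<^sup>2"
  unfolding norm_power2_frobenius sum.distrib [symmetric]
  by (intro sum.cong refl) (simp add: cmod_power2)

section \<open>Normality in terms of real and imaginary parts\<close>

lemma normal_matrices_Re_Im:
  fixes X :: "complex ^ 'n ^ 'n"
  assumes "X \<in> normal_matrices"
  defines "P \<equiv> map_matrix Re X" and "Q \<equiv> map_matrix Im X"
  shows "P ** transpose P + Q ** transpose Q = transpose P ** P + transpose Q ** Q"
proof -
  have "Re ((X ** conj_transpose X) $ i $ j) = Re ((conj_transpose X ** X) $ i $ j)" for i j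
    using assms by (simp add: normal_matrices_def)
  then show ?thesis
    by (simp add: vec_eq_iff P_def Q_def matrix_matrix_mult_def transpose_def conj_transpose_def
        flip: sum.distrib)
qed

text \<open>For real \<open>M\<close>, the defect \<open>M ** transpose M - transpose M ** M\<close>
  is -2 times the commutator of the symmetric and skew parts. The real part of the normality
  equation says that the defects of \<open>P\<close> and \<open>Q\<close> cancel.\<close>

lemma normal_matrices_commutator:
  fixes X :: "complex ^ 'n ^ 'n"
  assumes "X \<in> normal_matrices"
  defines "P \<equiv> map_matrix Re X" and "Q \<equiv> map_matrix Im X"
  shows "commutator (sym_part P) (skew_part P) = commutator (skew_part Q) (sym_part Q)"
proof -
  have twice: "M ** transpose M - transpose M ** M
      = (-2) *\<^sub>R commutator (sym_part M) (skew_part M)" for M :: "real^'n^'n"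
  proof -
    have "(S + K) ** (S - K) - (S - K) ** (S + K) = (-2) *\<^sub>R commutator S K" for S K :: "real^'n^'n"
      by (simp add: commutator_def matrix_add_ldistrib matrix_add_rdistrib matrix_diff_ldistrib
          matrix_diff_rdistrib algebra_simps scaleR_2)
    from this [of "sym_part M" "skew_part M"] show ?thesis
      by (simp only: sym_part_add_skew_part sym_part_diff_skew_part)
  qed
  have eq: "u + v = 0" if "a - b = u" "c - d = v" "a + c = b + d" for a b c d u v :: "real^'n^'n"
  proof -
    have "u + v = (a + c) - (b + d)"
      unfolding that(1,2) [symmetric] by (rule add_diff_add [symmetric])
    then show ?thesis using that(3) by simp
  qed
  have "(-2) *\<^sub>R commutator (sym_part P) (skew_part P) + (-2) *\<^sub>R commutator (sym_part Q) (skew_part Q) = 0"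
    by (rule eq [OF twice [of P] twice [of Q]]) (use normal_matrices_Re_Im [OF assms(1)] in \<open>simp only: P_def Q_def\<close>)
  then have "(-2) *\<^sub>R (commutator (sym_part P) (skew_part P) + commutator (sym_part Q) (skew_part Q)) = 0"
    by (simp only: scaleR_add_right)
  then have "commutator (sym_part P) (skew_part P) = - commutator (sym_part Q) (skew_part Q)"
    by (simp add: eq_neg_iff_add_eq_0)
  then show ?thesis by (simp add: commutator_def)
qed

lemma real_normal_matrices:
  fixes M :: "real ^ 'n ^ 'n"
  shows "map_matrix complex_of_real M \<in> normal_matrices \<longleftrightarrow> M ** transpose M = transpose M ** M"
proof -
  have "(map_matrix complex_of_real M ** conj_transpose (map_matrix complex_of_real M)) $ i $ j
      = complex_of_real ((M ** transpose M) $ i $ j)" 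
    "(conj_transpose (map_matrix complex_of_real M) ** map_matrix complex_of_real M) $ i $ j
      = complex_of_real ((transpose M ** M) $ i $ j)" for i j
    by (simp_all add: matrix_matrix_mult_def transpose_def conj_transpose_def)
  then show ?thesis
    by (simp add: normal_matrices_def vec_eq_iff)
qed

lemma d_complex_le_d_real: "d_complex A \<le> d_real A"
  using d_complex_minimum [of A] d_real_minimum [of A] by fastforce

lemma d_real_le_norm_skew_part: "d_real A \<le> norm (skew_part A)"
proof -
  have "A - sym_part A = skew_part A"
    using sym_part_add_skew_part [of A] by (simp add: algebra_simps)
  moreover have "map_matrix complex_of_real (sym_part A) \<in> normal_matrices \<inter> real_matrices"
    by (simp add: real_normal_matrices transpose_sym_part real_matrices_def)
  ultimately show ?thesis
    using d_real_minimum [of A] by (metis map_matrix_of_real_diff norm_map_matrix_of_real)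
qed

section \<open>Agreement of the distances near a diagonal matrix\<close>

text \<open>The commutator multiplies entry (i, j) by the difference of two distinct integers when i
  \<noteq> j, and a skew matrix has zero diagonal.\<close>

lemma norm_commutator_diagonal_ge:
  fixes d :: "'n::finite \<Rightarrow> nat"
  assumes "inj d" and skew: "transpose L = - L"
  shows "norm L \<le> norm (commutator (\<chi> i j. if i = j then real (d i) else 0) L)" (is "_ \<le> norm (commutator ?D L)")
proof -
  have "commutator ?D L $ i $ j = (real (d i) - real (d j)) * L $ i $ j" for i j
    by (simp add: commutator_def matrix_matrix_mult_def if_distrib if_distribR sum.delta sum.delta' left_diff_distrib cong: if_cong)
  moreover have "\<bar>L $ i $ j\<bar> \<le> \<bar>real (d i) - real (d j)\<bar> * \<bar>L $ i $ j\<bar>" for i j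
  proof (cases "i = j")
    case True
    have "transpose L $ i $ i = (- L) $ i $ i" by (simp only: skew)
    then show ?thesis using True by (simp add: transpose_def)
  next
    case False
    then have "1 \<le> \<bar>real (d i) - real (d j)\<bar>"
      using injD [OF \<open>inj d\<close>, of i j] by force
    then show ?thesis
      using mult_right_mono [of 1 _ "\<bar>L $ i $ j\<bar>"] by simp
  qed
  ultimately show ?thesis
    by (intro norm_le_componentwise_cart) (simp add: abs_mult)
qed

lemma d_real_eq_d_complex_near_diagonal:
  fixes d :: "'n::finite \<Rightarrow> nat"
  assumes "inj d" and A: "norm (A - (\<chi> i j. if i = j then real (d i) else 0)) \<le> 1/4" (is "norm (A - ?D) \<le> _")
  shows "d_real A = d_complex A"
proof -
  define S K where "S = sym_part A" and "K = skew_part A"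
  have D: "sym_part ?D = ?D" "skew_part ?D = 0"
    by (auto simp: sym_part_def skew_part_def transpose_def vec_eq_iff)
  have SD: "norm (S - ?D) \<le> 1/4"
    using norm_sym_part_le [of "A - ?D"] A D by (simp add: S_def sym_part_diff)
  have K: "norm K \<le> 1/4"
    using norm_skew_part_le [of "A - ?D"] A D by (simp add: K_def skew_part_diff)
  \<comment> \<open>The gap 1 of the diagonal matrix loses at most 2 * 1/4 when the matrix is
    replaced by \<open>S\<close>.\<close>
  have gap: "norm L / 2 \<le> norm (commutator S L)" if "transpose L = - L" for L
  proof -
    have "commutator ?D L = commutator S L - commutator (S - ?D) L"
      using commutator_add_left [of ?D "S - ?D" L] by simp
    moreover have "norm (commutator (S - ?D) L) \<le> norm L / 2"
      using norm_commutator_le [of "S - ?D" L] mult_right_mono [OF SD, of "norm L"] by simp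
    ultimately show ?thesis
      using norm_commutator_diagonal_ge [OF \<open>inj d\<close> that]
        norm_triangle_ineq4 [of "commutator S L" "commutator (S - ?D) L"] by simp
  qed
  have "norm K \<le> norm (map_matrix complex_of_real A - X)" if X: "X \<in> normal_matrices" for X
  proof -
    define P Q where "P = map_matrix Re X" and "Q = map_matrix Im X"
    define F L where "F = S - sym_part P" and "L = skew_part P"
    have "commutator S L = commutator F L + commutator (sym_part P) L"
      using commutator_add_left [of F "sym_part P" L] by (simp add: F_def)
    also have "commutator (sym_part P) L = commutator (skew_part Q) (sym_part Q)"
      using normal_matrices_commutator [OF X] by (simp add: P_def Q_def L_def)
    finally have "norm L / 2 \<le> norm (commutator F L) + norm (commutator (skew_part Q) (sym_part Q))"
      using gap [of L] norm_triangle_ineq by (metis L_def order_trans transpose_skew_part)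
    then have L: "norm L \<le> 4 * (norm F * norm L + norm (skew_part Q) * norm (sym_part Q))"
      using norm_commutator_le [of F L] norm_commutator_le [of "skew_part Q" "sym_part Q"] by simp
    \<comment> \<open>The cross term is the only possible gain from a nonzero \<open>L\<close>. The
      bound 1/4 on \<open>K\<close> limits it to \<open>norm L / 2\<close>, which \<open>L\<close>
      in turn bounds by products of the other errors.\<close>
    have "2 * (K \<bullet> L) \<le> 2 * (norm K * norm L)"
      using norm_cauchy_schwarz [of K L] by simp
    also have "\<dots> \<le> norm L / 2"
      using mult_right_mono [OF K, of "norm L"] by simp
    also have "\<dots> \<le> 2 * norm F * norm L + 2 * norm (skew_part Q) * norm (sym_part Q)"
      using L by simp
    \<comment> \<open>AM-GM gives exactly the squares that accompany
      \<open>(norm K)\<^sup>2 - 2 * (K \<bullet> L)\<close> in the squared distance computed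
      next.\<close>
    also have "\<dots> \<le> (norm F)\<^sup>2 + (norm L)\<^sup>2 + (norm (skew_part Q))\<^sup>2 + (norm (sym_part Q))\<^sup>2"
      using sum_squares_bound [of "norm F" "norm L"] sum_squares_bound [of "norm (skew_part Q)" "norm (sym_part Q)"] by simp
    finally have KL: "2 * (K \<bullet> L) \<le> (norm F)\<^sup>2 + (norm L)\<^sup>2 + (norm (skew_part Q))\<^sup>2 + (norm (sym_part Q))\<^sup>2" .
    have "(norm (map_matrix complex_of_real A - X))\<^sup>2
        = (norm F)\<^sup>2 + (norm (K - L))\<^sup>2 + (norm (sym_part Q))\<^sup>2 + (norm (skew_part Q))\<^sup>2"
      using norm_sym_skew [of "A - P"] norm_sym_skew [of Q]
      by (simp add: norm_complex_matrix_split P_def Q_def F_def L_def S_def K_def sym_part_diff skew_part_diff)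
    also have "(norm (K - L))\<^sup>2 = (norm K)\<^sup>2 - 2 * (K \<bullet> L) + (norm L)\<^sup>2"
      by (simp add: power2_norm_eq_inner inner_diff_left inner_diff_right inner_commute)
    finally have "(norm K)\<^sup>2 \<le> (norm (map_matrix complex_of_real A - X))\<^sup>2"
      using KL by simp
    then show ?thesis by (rule power2_le_imp_le) simp
  qed
  then have "norm K \<le> d_complex A"
    using d_complex_minimum [of A] by force
  then show ?thesis
    using d_real_le_norm_skew_part [of A] d_complex_le_d_real [of A] by (simp add: K_def)
qed

section \<open>A matrix whose nearest normal matrices are not real\<close>

text \<open>The equations say that the symmetric matrix H = (hij) commutes with the cross product by
  r = (x, y, z). Hence r is an eigenvector and H is scalar on the plane orthogonal to r.\<close>

lemma commuting_sym_skew3: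
  fixes h11 h12 h13 h22 h23 h33 x y z :: real
  assumes "h12 * z = h13 * y" "h13 * y = h23 * x"
    and "z * (h11 - h22) = x * h13 - y * h23"
    and "x * (h22 - h33) = y * h12 - z * h13"
    and "y * (h33 - h11) = z * h23 - x * h12"
    and nz: "x\<^sup>2 + y\<^sup>2 + z\<^sup>2 \<noteq> 0"
  obtains \<alpha> \<beta> where "h11 = \<alpha> + \<beta> * x\<^sup>2" "h22 = \<alpha> + \<beta> * y\<^sup>2" "h33 = \<alpha> + \<beta> * z\<^sup>2"
    "h12 = \<beta> * x * y" "h13 = \<beta> * x * z" "h23 = \<beta> * y * z"
proof
  \<comment> \<open>Here n is the squared length of r, q is the quadratic form of H at r and t is
    the trace. The coefficients solve t = 3 \<alpha> + \<beta> n and q = \<alpha> n + \<beta>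
    n^2.\<close>
  define n where "n = x\<^sup>2 + y\<^sup>2 + z\<^sup>2"
  define q where "q = h11 * x\<^sup>2 + h22 * y\<^sup>2 + h33 * z\<^sup>2 + 2 * (h12 * x * y + h13 * x * z + h23 * y * z)"
  define t where "t = h11 + h22 + h33"
  define \<alpha> where "\<alpha> = (n * t - q) / (2 * n)"
  define \<beta> where "\<beta> = (3 * q - n * t) / (2 * n\<^sup>2)"
  have n0: "n \<noteq> 0" using nz by (simp add: n_def)
  have b: "\<beta> * (2 * n\<^sup>2) = 3 * q - n * t" and a: "\<alpha> * (2 * n\<^sup>2) = n * (n * t - q)"
    using n0 by (simp_all add: \<alpha>_def \<beta>_def power2_eq_square)
  have eqI: "u = v" if "2 * n\<^sup>2 * u = v * (2 * n\<^sup>2)" for u v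
    using that n0 by simp
  have "2 * n\<^sup>2 * h11 = n * (n * t - q) + (3 * q - n * t) * x\<^sup>2"
    "2 * n\<^sup>2 * h22 = n * (n * t - q) + (3 * q - n * t) * y\<^sup>2"
    "2 * n\<^sup>2 * h33 = n * (n * t - q) + (3 * q - n * t) * z\<^sup>2"
    using assms(1-5) unfolding n_def q_def t_def by algebra+
  then show "h11 = \<alpha> + \<beta> * x\<^sup>2" "h22 = \<alpha> + \<beta> * y\<^sup>2" "h33 = \<alpha> + \<beta> * z\<^sup>2"
    by - (rule eqI, use a b in algebra)+
  have "2 * n\<^sup>2 * h12 = (3 * q - n * t) * x * y"
    "2 * n\<^sup>2 * h13 = (3 * q - n * t) * x * z"
    "2 * n\<^sup>2 * h23 = (3 * q - n * t) * y * z"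
    using assms(1-5) unfolding n_def q_def t_def by algebra+
  then show "h12 = \<beta> * x * y" "h13 = \<beta> * x * z" "h23 = \<beta> * y * z"
    by - (rule eqI, use b in algebra)+
qed

lemma real_normal3_lower_bound:
  fixes m11 m12 m13 m21 m22 m23 m31 m32 m33 :: real
  assumes "m12\<^sup>2 + m13\<^sup>2 = m21\<^sup>2 + m31\<^sup>2"
    and "m21\<^sup>2 + m23\<^sup>2 = m12\<^sup>2 + m32\<^sup>2"
    and "m11 * m21 + m12 * m22 + m13 * m23 = m11 * m12 + m21 * m22 + m31 * m32"
    and "m11 * m31 + m12 * m32 + m13 * m33 = m11 * m13 + m21 * m23 + m31 * m33"
    and "m21 * m31 + m22 * m32 + m23 * m33 = m12 * m13 + m22 * m23 + m32 * m33"
  shows "8 \<le> m11\<^sup>2 + (m12 - 3)\<^sup>2 + m13\<^sup>2 + (m21 - 3)\<^sup>2 + m22\<^sup>2 + (m23 + 2)\<^sup>2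
    + m31\<^sup>2 + (m32 - 2)\<^sup>2 + m33\<^sup>2" (is "8 \<le> ?R")
proof -
  \<comment> \<open>The skew part is the cross product by (x, y, z); the target has skew axis (2, 0,
    0) and symmetric part with only the off-diagonal entry 3.\<close>
  define h12 h13 h23 where "h12 = (m12 + m21) / 2" and "h13 = (m13 + m31) / 2" and "h23 = (m23 + m32) / 2"
  define x y z where "x = (m32 - m23) / 2" and "y = (m13 - m31) / 2" and "z = (m21 - m12) / 2"
  have m: "m12 = h12 - z" "m21 = h12 + z" "m13 = h13 + y" "m31 = h13 - y" "m23 = h23 - x" "m32 = h23 + x"
    by (simp_all add: h12_def h13_def h23_def x_def y_def z_def field_simps)
  have R: "?R = m11\<^sup>2 + m22\<^sup>2 + m33\<^sup>2 + 2 * (h12 - 3)\<^sup>2 + 2 * h13\<^sup>2 + 2 * h23\<^sup>2 + 2 * y\<^sup>2 + 2 * z\<^sup>2 + 2 * (x - 2)\<^sup>2"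
    unfolding m by algebra
  show ?thesis
  proof (cases "x\<^sup>2 + y\<^sup>2 + z\<^sup>2 = 0")
    case True
    then have "x = 0" "y = 0" "z = 0"
      by (smt (verit) zero_le_power2 power2_eq_iff_nonneg zero_eq_power2)+
    \<comment> \<open>For symmetric M, the term \<open>2 * (x - 2)\<^sup>2\<close> alone is
      8.\<close>
    then show ?thesis unfolding R by simp
  next
    case False
    have "h12 * z = h13 * y" "h13 * y = h23 * x" "z * (m11 - m22) = x * h13 - y * h23"
      "x * (m22 - m33) = y * h12 - z * h13" "y * (m33 - m11) = z * h23 - x * h12"
      using assms unfolding m by algebra+
    then obtain \<alpha> \<beta> where h: "m11 = \<alpha> + \<beta> * x\<^sup>2" "m22 = \<alpha> + \<beta> * y\<^sup>2" "m33 = \<alpha> + \<beta> * z\<^sup>2"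
      "h12 = \<beta> * x * y" "h13 = \<beta> * x * z" "h23 = \<beta> * y * z"
      using commuting_sym_skew3 False by metis
    define n where "n = x\<^sup>2 + y\<^sup>2 + z\<^sup>2"
    have n: "n > 0" using False unfolding n_def
      by (smt (verit) zero_le_power2)
    \<comment> \<open>Squares of the first two coordinates of the unit axis; the bound will depend
      on these alone.\<close>
    define a b where "a = x\<^sup>2 / n" and "b = y\<^sup>2 / n"
    have ab: "0 \<le> a" "0 \<le> b" "a + b \<le> 1"
      using n by (auto simp: a_def b_def n_def add_divide_distrib [symmetric] divide_le_eq)
    have "?R = (\<alpha> + \<beta> * x\<^sup>2)\<^sup>2 + (\<alpha> + \<beta> * y\<^sup>2)\<^sup>2 + (\<alpha> + \<beta> * z\<^sup>2)\<^sup>2 + 2 * (\<beta> * x * y - 3)\<^sup>2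
        + 2 * (\<beta> * x * z)\<^sup>2 + 2 * (\<beta> * y * z)\<^sup>2 + 2 * y\<^sup>2 + 2 * z\<^sup>2 + 2 * (x - 2)\<^sup>2"
      unfolding R by (simp only: h)
    also have "\<dots> = 26 - 12 * \<beta> * x * y + 3 * \<alpha>\<^sup>2 + 2 * \<alpha> * \<beta> * n + (\<beta> * n)\<^sup>2 + 2 * n - 8 * x" (is "_ = ?Q")
      unfolding n_def by algebra
    \<comment> \<open>Squares are completed successively in \<alpha>, in \<beta> and in the length
      of the axis.\<close>
    also have "?Q = 26 + 3 * (\<alpha> + \<beta> * n / 3)\<^sup>2 + 2 / 3 * (\<beta> * n - 9 * x * y / n)\<^sup>2 + 2 * (n - 2 * x)\<^sup>2 / n
        - 54 * (a * b) - 8 * a"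
    proof -
      have "(\<beta> * n - 9 * x * y / n)\<^sup>2 = (\<beta> * n)\<^sup>2 - 18 * \<beta> * x * y + 81 * (a * b)"
      proof -
        have "(\<beta> * n) * (9 * x * y / n) = 9 * \<beta> * x * y" using n by simp
        moreover have "(9 * x * y / n)\<^sup>2 = 81 * (a * b)"
          by (simp add: a_def b_def power2_eq_square)
        ultimately show ?thesis unfolding power2_diff by linarith
      qed
      moreover have "(n - 2 * x)\<^sup>2 / n = n - 4 * x + 4 * a"
        using n by (simp add: a_def power2_eq_square field_simps)
      moreover have "(\<alpha> + \<beta> * n / 3)\<^sup>2 = \<alpha>\<^sup>2 + 2 / 3 * \<alpha> * \<beta> * n + (\<beta> * n)\<^sup>2 / 9"
        by (simp add: power2_eq_square algebra_simps)
      ultimately show ?thesis by (simp add: algebra_simps)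
    qed
    finally have "?R \<ge> 26 - 54 * (a * b) - 8 * a"
      using n by (simp add: add_nonneg_nonneg)
    moreover have "a * b \<le> a * (1 - a)"
      using ab by (intro mult_left_mono) auto
    \<comment> \<open>The maximum, at a = 31/54, is 18 - 11/54, so this case stays strictly above
      8.\<close>
    moreover have "54 * (a * (1 - a)) + 8 * a \<le> 18"
    proof -
      have "54 * (a * (1 - a)) + 8 * a = 18 - 54 * (a - 31/54)\<^sup>2 - 11/54"
        by (simp add: power2_eq_square field_simps)
      then show ?thesis using zero_le_power2 [of "a - 31/54"] by linarith
    qed
    ultimately show ?thesis by linarith
  qed
qed

section \<open>Direct sums with multiples of the identity\<close>

text \<open>For injective \<open>e\<close>, the matrix \<open>block e M k\<close> is \<open>M \<oplus> k I\<close>, with \<open>M\<close> placed on the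
  index set \<open>range e\<close>.\<close>

definition block :: "('m \<Rightarrow> 'n) \<Rightarrow> 'a ^ 'm ^ 'm \<Rightarrow> 'a \<Rightarrow> 'a::zero ^ 'n ^ 'n" where
  "block e M k = (\<chi> i j. if i \<in> range e \<and> j \<in> range e then M $ inv e i $ inv e j
    else if i = j then k else 0)"

lemma block_nth:
  assumes "inj e"
  shows "block e M k $ e i $ e j = M $ i $ j"
    and "q \<notin> range e \<Longrightarrow> block e M k $ e i $ q = 0"
    and "q \<notin> range e \<Longrightarrow> block e M k $ q $ e i = 0"
    and "p \<notin> range e \<Longrightarrow> q \<notin> range e \<Longrightarrow> block e M k $ p $ q = (if p = q then k else 0)"
  using assms by (auto simp: block_def)

lemma sum_range_split:
  fixes e :: "'m::finite \<Rightarrow> 'n::finite" and f :: "'n \<Rightarrow> 'b::comm_monoid_add"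
  assumes "inj e"
  shows "(\<Sum>p\<in>UNIV. f p) = (\<Sum>i\<in>UNIV. f (e i)) + (\<Sum>p\<in>- range e. f p)"
proof -
  have "(\<Sum>p\<in>UNIV. f p) = (\<Sum>p\<in>range e. f p) + (\<Sum>p\<in>UNIV - range e. f p)"
    by (subst sum.subset_diff [of "range e"]) (auto simp: add.commute)
  also have "(\<Sum>p\<in>range e. f p) = (\<Sum>i\<in>UNIV. f (e i))"
    using assms by (simp add: sum.reindex)
  finally show ?thesis by (simp add: Compl_eq_Diff_UNIV)
qed

lemma norm_block_0:
  fixes e :: "'m::finite \<Rightarrow> 'n::finite" and M :: "'a::real_normed_vector ^ 'm ^ 'm"
  assumes "inj e"
  shows "norm (block e M 0) = norm M"
  by (simp add: norm_eq_frobenius sum_range_split [OF assms] block_nth [OF assms])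

lemma block_normal:
  fixes e :: "'m::finite \<Rightarrow> 'n::finite"
  assumes e: "inj e" and M: "M \<in> normal_matrices"
  shows "block e M k \<in> normal_matrices"
proof -
  have M: "(\<Sum>m\<in>UNIV. M $ i $ m * cnj (M $ j $ m)) = (\<Sum>m\<in>UNIV. cnj (M $ m $ i) * M $ m $ j)" for i j
    using M by (simp add: normal_matrices_def vec_eq_iff matrix_matrix_mult_def conj_transpose_def transpose_def)
  let ?B = "block e M k"
  have "(\<Sum>m\<in>UNIV. ?B $ p $ m * cnj (?B $ q $ m)) = (\<Sum>m\<in>UNIV. cnj (?B $ m $ p) * ?B $ m $ q)" for p q
  proof (cases "p \<in> range e"; cases "q \<in> range e")
    assume "p \<in> range e" "q \<in> range e"
    then show ?thesis
      using M by (auto simp: sum_range_split [OF e] block_nth [OF e])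
  next
    assume "p \<in> range e" "q \<notin> range e"
    then show ?thesis
      by (auto simp: sum_range_split [OF e] block_nth [OF e])
  next
    assume "p \<notin> range e" "q \<in> range e"
    then show ?thesis
      by (auto simp: sum_range_split [OF e] block_nth [OF e])
  next
    assume "p \<notin> range e" "q \<notin> range e"
    then show ?thesis
      by (auto intro!: sum.cong simp: sum_range_split [OF e] block_nth [OF e])
  qed
  then show ?thesis
    by (simp add: normal_matrices_def vec_eq_iff matrix_matrix_mult_def conj_transpose_def transpose_def)
qed

lemma map_matrix_block: "map_matrix complex_of_real (block e M k) = block e (map_matrix complex_of_real M) (complex_of_real k)"
  by (simp add: block_def vec_eq_iff)

lemma block_diff: "block e M k - block e N k = block e (M - N) (0::'a::ab_group_add)"
  by (simp add: block_def vec_eq_iff)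

text \<open>Padding a nearest normal matrix of \<open>M\<close> with the same k I keeps it normal
  and leaves the error unchanged.\<close>

lemma d_complex_block_le:
  assumes "inj e"
  shows "d_complex (block e M k) \<le> d_complex M"
proof -
  obtain X where X: "X \<in> normal_matrices" "d_complex M = norm (map_matrix complex_of_real M - X)"
    using d_complex_minimum by blast
  have "d_complex (block e M k) \<le> norm (map_matrix complex_of_real (block e M k) - block e X (complex_of_real k))"
    using d_complex_minimum block_normal [OF assms X(1)] by blast
  also have "\<dots> = d_complex M"
    by (simp add: X(2) map_matrix_block block_diff norm_block_0 [OF assms])
  finally show ?thesis .
qed

lemma block_add: "block e M k + block e N l = block e (M + N) (k + l::'a::monoid_add)"
  by (simp add: block_def vec_eq_iff)

text \<open>At an index pair in \<open>range e \<times> - range e\<close>, normality of \<open>block e M k + Z k\<close> reads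
  \<open>k (Z k - (Z k)\<^sup>T) = O(1)\<close>.  Hence the limit \<open>Z\<close> is symmetric at these pairs, their contributions
  cancel, and \<open>M\<close> plus the compression of \<open>Z\<close> to \<open>range e\<close> is normal.\<close>

lemma d_real_le_of_block:
  fixes e :: "'m::finite \<Rightarrow> 'n::finite" and M :: "real ^ 'm ^ 'm"
  assumes e: "inj e" and le: "\<And>k::nat. d_real (block e M (real (Suc k))) \<le> \<delta>"
  shows "d_real M \<le> \<delta>"
proof -
  have "\<exists>Z. norm Z \<le> \<delta> \<and> (block e M (real (Suc k)) + Z) ** transpose (block e M (real (Suc k)) + Z)
      = transpose (block e M (real (Suc k)) + Z) ** (block e M (real (Suc k)) + Z)" for k
  proof -
    obtain X where X: "X \<in> normal_matrices" "X \<in> real_matrices"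
      "norm (map_matrix complex_of_real (block e M (real (Suc k))) - X) \<le> \<delta>"
      using d_real_minimum [of "block e M (real (Suc k))"] le [of k] by auto
    obtain Y where Y: "X = map_matrix complex_of_real Y"
      using X(2) by (auto simp: real_matrices_def)
    have "norm (Y - block e M (real (Suc k))) \<le> \<delta>"
      using X(3) by (simp only: Y map_matrix_of_real_diff norm_map_matrix_of_real norm_minus_commute)
    moreover have "Y ** transpose Y = transpose Y ** Y"
      using X(1) by (simp add: Y real_normal_matrices)
    ultimately show ?thesis
      by (intro exI [of _ "Y - block e M (real (Suc k))"]) simp
  qed
  then obtain Z where Z: "\<And>k. norm (Z k) \<le> \<delta>" and normal:
    "\<And>k. (block e M (real (Suc k)) + Z k) ** transpose (block e M (real (Suc k)) + Z k)
      = transpose (block e M (real (Suc k)) + Z k) ** (block e M (real (Suc k)) + Z k)"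
    by metis
  \<comment> \<open>The perturbations stay in a compact ball, so a subsequence converges.\<close>
  have "seq_compact (cball 0 \<delta> :: (real ^ 'n ^ 'n) set)"
    by (simp add: compact_imp_seq_compact)
  then obtain W r where W: "norm W \<le> \<delta>" and r: "strict_mono r" and lim: "(Z \<circ> r) \<longlonglongrightarrow> W"
    using Z unfolding seq_compact_def by (metis mem_cball_0)
  \<comment> \<open>The part that remains bounded as k grows: the normal matrix is k I on the
    complement of \<open>range e\<close>, plus \<open>N k\<close>, with
    \<open>real (Suc (r k))\<close> in the role of k. The \<open>Suc\<close> keeps this factor
    nonzero for the later division.\<close>
  define N where "N k = block e M 0 + Z (r k)" for k
  define L where "L = block e M 0 + W"
  have "N \<longlonglongrightarrow> L"
    unfolding N_def L_def using lim by (intro tendsto_intros) (simp add: o_def)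
  then have N [tendsto_intros]: "(\<lambda>k. N k $ p $ q) \<longlonglongrightarrow> L $ p $ q" for p q
    by (intro tendsto_intros)
  have Y: "block e M (real (Suc k)) + Z k = block e 0 (real (Suc k)) + (block e M 0 + Z k)" for k
    using block_add [of e 0 "real (Suc k)" M 0] by (simp add: add.assoc [symmetric])
  have eq: "(\<Sum>m\<in>UNIV. (block e 0 (real (Suc (r k))) + N k) $ p $ m * (block e 0 (real (Suc (r k))) + N k) $ q $ m)
      = (\<Sum>m\<in>UNIV. (block e 0 (real (Suc (r k))) + N k) $ m $ p * (block e 0 (real (Suc (r k))) + N k) $ m $ q)" for k p q
    using normal [of "r k"] unfolding Y N_def [symmetric]
    by (simp add: vec_eq_iff matrix_matrix_mult_def transpose_def)
  \<comment> \<open>The rows and columns of \<open>block e 0 c\<close> indexed by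
    \<open>range e\<close> vanish, so k drops out and the limit can be taken.\<close>
  have NN: "(\<Sum>m\<in>UNIV. N k $ e i $ m * N k $ e j $ m) = (\<Sum>m\<in>UNIV. N k $ m $ e i * N k $ m $ e j)" for k i j
    using eq [of k "e i" "e j"] by (simp add: sum_range_split [OF e] block_nth [OF e])
  have "(\<lambda>k. \<Sum>m\<in>UNIV. N k $ m $ e i * N k $ m $ e j) \<longlonglongrightarrow> (\<Sum>m\<in>UNIV. L $ e i $ m * L $ e j $ m)" for i j
    unfolding NN [symmetric] by (intro tendsto_intros)
  moreover have "(\<lambda>k. \<Sum>m\<in>UNIV. N k $ m $ e i * N k $ m $ e j) \<longlonglongrightarrow> (\<Sum>m\<in>UNIV. L $ m $ e i * L $ m $ e j)" for i j
    by (intro tendsto_intros)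
  ultimately have L: "(\<Sum>m\<in>UNIV. L $ e i $ m * L $ e j $ m) = (\<Sum>m\<in>UNIV. L $ m $ e i * L $ m $ e j)" for i j
    by (rule LIMSEQ_unique)
  have sym: "L $ e i $ q = L $ q $ e i" if q: "q \<notin> range e" for i q
  proof -
    let ?g = "\<lambda>k. (\<Sum>m\<in>UNIV. N k $ m $ e i * N k $ m $ q) - (\<Sum>m\<in>UNIV. N k $ e i $ m * N k $ q $ m)"
    have "N k $ e i $ q - N k $ q $ e i = ?g k / real (Suc (r k))" for k
    proof -
      have delta: "(block e 0 c) $ q $ m = (if m = q then c else 0)"
        "(block e 0 c) $ m $ q = (if m = q then c else 0)" for m and c :: real
        using q by (cases "m \<in> range e"; auto simp: block_nth [OF e])+
      have zero: "(block e 0 c) $ e i $ m = 0" "(block e 0 c) $ m $ e i = 0" for m and c :: real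
        by (cases "m \<in> range e"; auto simp: block_nth [OF e])+
      have "?g k = real (Suc (r k)) * (N k $ e i $ q - N k $ q $ e i)"
        using eq [of k "e i" q]
        by (simp add: delta zero distrib_left sum.distrib if_distrib [of "\<lambda>x. y * x" for y] cong: if_cong)
          (simp add: algebra_simps)
      then show ?thesis by simp
    qed
    moreover have "(\<lambda>k. ?g k / real (Suc (r k))) \<longlonglongrightarrow> 0"
    proof (rule real_tendsto_divide_at_top)
      show "?g \<longlonglongrightarrow> (\<Sum>m\<in>UNIV. L $ m $ e i * L $ m $ q) - (\<Sum>m\<in>UNIV. L $ e i $ m * L $ q $ m)"
        by (intro tendsto_intros)
      show "filterlim (\<lambda>k. real (Suc (r k))) at_top sequentially"
        using filterlim_subseq [OF r]
        by (intro filterlim_compose [OF filterlim_real_sequentially] filterlim_compose [OF filterlim_Suc])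
    qed
    ultimately have "(\<lambda>k. N k $ e i $ q - N k $ q $ e i) \<longlonglongrightarrow> 0"
      by simp
    moreover have "(\<lambda>k. N k $ e i $ q - N k $ q $ e i) \<longlonglongrightarrow> L $ e i $ q - L $ q $ e i"
      by (intro tendsto_intros)
    ultimately show ?thesis using LIMSEQ_unique by fastforce
  qed
  define V where "V = (\<chi> i j. W $ e i $ e j)"
  have LV: "L $ e i $ e j = (M + V) $ i $ j" for i j
    by (simp add: L_def V_def block_nth [OF e])
  have "(\<Sum>m\<in>UNIV. (M + V) $ i $ m * (M + V) $ j $ m) = (\<Sum>m\<in>UNIV. (M + V) $ m $ i * (M + V) $ m $ j)" for i j
  proof -
    have "(\<Sum>q\<in>- range e. L $ e i $ q * L $ e j $ q) = (\<Sum>q\<in>- range e. L $ q $ e i * L $ q $ e j)"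
      by (intro sum.cong) (auto simp: sym)
    then show ?thesis
      using L [of i j] unfolding sum_range_split [OF e] LV by simp
  qed
  then have "map_matrix complex_of_real (M + V) \<in> normal_matrices"
    by (simp add: real_normal_matrices vec_eq_iff matrix_matrix_mult_def transpose_def)
  then have "map_matrix complex_of_real (M + V) \<in> normal_matrices \<inter> real_matrices"
    by (auto simp: real_matrices_def)
  then have "d_real M \<le> norm (M - (M + V))"
    using d_real_minimum [of M] by (metis map_matrix_of_real_diff norm_map_matrix_of_real)
  also have "\<dots> = norm V" by simp
  \<comment> \<open>Compression only discards entries.\<close>
  also have "\<dots> \<le> norm W"
    unfolding norm_eq_frobenius sum_range_split [OF e]
    by (intro real_sqrt_le_mono) (auto simp: V_def intro!: add_increasing2 sum_nonneg sum_mono)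
  finally show ?thesis using W by simp
qed

text \<open>Otherwise every \<open>block e M k\<close> has real distance at most
  \<open>d_complex M\<close>, and letting k grow gives the same bound for
  \<open>d_real M\<close>.\<close>

lemma block_d_complex_less_d_real:
  fixes e :: "'m::finite \<Rightarrow> 'n::finite" and M :: "real ^ 'm ^ 'm"
  assumes "inj e" "d_complex M < d_real M"
  shows "\<exists>A :: real ^ 'n ^ 'n. d_complex A < d_real A"
proof (rule ccontr)
  assume "\<not> ?thesis"
  then have "d_real (block e M k) \<le> d_complex M" for k
    using d_complex_block_le [OF assms(1), of M k] by (meson not_less order_trans)
  then have "d_real M \<le> d_complex M"
    using d_real_le_of_block [OF assms(1)] by blast
  then show False using assms(2) by simp
qed

section \<open>The 3 x 3 example\<close>

definition example3 :: "real ^ 3 ^ 3" where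
  "example3 = vector [vector [0, 3, 0], vector [3, 0, -2], vector [0, 2, 0]]"

text \<open>With the orthonormal basis \<open>v = (1, 0, 0)\<close>, \<open>f = (0, c, i s)\<close>, \<open>u = (0, i s, c)\<close> and \<open>s\<^sup>2 = 1/10\<close>,
  \<open>c\<^sup>2 = 9/10\<close>, this is \<open>3 c (v f\<^sup>* + f v\<^sup>*) + 2 i s c (3 u u\<^sup>* - I)\<close>.\<close>

definition example3_near :: "complex ^ 3 ^ 3" where
  "example3_near = vector [vector [- 3/5 * \<i>, 27/10, - 9/10 * \<i>], vector [27/10, - 21/50 * \<i>, - 27/50],
    vector [9/10 * \<i>, 27/50, 51/50 * \<i>]]"

lemma d_complex_example3: "d_complex example3 < sqrt 8"
proof -
  have "example3_near \<in> normal_matrices"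
    by (simp add: normal_matrices_def vec_eq_iff forall_3 matrix_matrix_mult_def sum_3 conj_transpose_def
      transpose_def example3_near_def)
  then have "d_complex example3 \<le> norm (map_matrix complex_of_real example3 - example3_near)"
    using d_complex_minimum by blast
  \<comment> \<open>For the family described at \<open>example3_near\<close> the squared distance is
    8 - 6 s^2 + 24 s^4, below 8 when 0 < s^2 < 1/4; at s^2 = 1/10 the product s c = 3/10 is
    rational.\<close>
  also have "\<dots> = sqrt (191/25)"
    unfolding norm_eq_frobenius
    by (simp add: sum_3 example3_def example3_near_def norm_mult cmod_power2 power_mult_distrib power_divide)
  also have "\<dots> < sqrt 8" by simp
  finally show ?thesis .
qed

lemma d_real_example3: "sqrt 8 \<le> d_real example3"
proof -
  obtain X where X: "X \<in> normal_matrices" "X \<in> real_matrices"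
    "d_real example3 = norm (map_matrix complex_of_real example3 - X)"
    using d_real_minimum [of example3] by auto
  obtain Y where Y: "X = map_matrix complex_of_real Y"
    using X(2) by (auto simp: real_matrices_def)
  have "(Y ** transpose Y) $ i $ j = (transpose Y ** Y) $ i $ j" for i j
    using X(1) by (simp add: Y real_normal_matrices)
  then have eq: "(\<Sum>m\<in>UNIV. Y $ i $ m * Y $ j $ m) = (\<Sum>m\<in>UNIV. Y $ m $ i * Y $ m $ j)" for i j
    by (simp add: matrix_matrix_mult_def transpose_def)
  have "8 \<le> (Y$1$1)\<^sup>2 + (Y$1$2 - 3)\<^sup>2 + (Y$1$3)\<^sup>2 + (Y$2$1 - 3)\<^sup>2 + (Y$2$2)\<^sup>2 + (Y$2$3 + 2)\<^sup>2
    + (Y$3$1)\<^sup>2 + (Y$3$2 - 2)\<^sup>2 + (Y$3$3)\<^sup>2"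
    using eq [of 1 1] eq [of 2 2] eq [of 1 2] eq [of 1 3] eq [of 2 3]
    by (intro real_normal3_lower_bound) (simp_all add: sum_3 power2_eq_square)
  also have "\<dots> = (norm (Y - example3))\<^sup>2"
    by (simp add: norm_eq_frobenius sum_3 example3_def sum_nonneg)
  finally have "sqrt 8 \<le> norm (Y - example3)"
    by (rule real_le_lsqrt [rotated]) auto
  then show ?thesis
    by (simp add: X(3) Y map_matrix_of_real_diff norm_map_matrix_of_real norm_minus_commute)
qed

section \<open>Both events have positive probability\<close>

theorem mainTheorem5:
  assumes "CARD('n::finite) \<ge> 3"
  shows "0 < measure uniform_unit_sphere {A :: real ^ 'n ^ 'n. norm A = 1 \<and> d_real A = d_complex A}
    \<and> measure uniform_unit_sphere {A :: real ^ 'n ^ 'n. norm A = 1 \<and> d_real A = d_complex A} < 1"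
proof
  let ?E = "{A :: real ^ 'n ^ 'n. norm A = 1 \<and> d_real A = d_complex A}"
  interpret S: prob_space "uniform_unit_sphere :: (real ^ 'n ^ 'n) measure"
    by (rule prob_space_uniform_unit_sphere)
  have "closed ?E"
    by (intro closed_Collect_conj closed_Collect_eq continuous_intros continuous_on_d)
  then have E [measurable]: "?E \<in> sets borel" by (rule borel_closed)
  \<comment> \<open>Distinct naturals on the diagonal are at least 1 apart, as the perturbation
    bound requires.\<close>
  obtain d :: "'n \<Rightarrow> nat" where d: "inj d"
    using finite_imp_inj_to_nat_seg [of "UNIV :: 'n set"] by auto
  let ?D = "(\<chi> i j. if i = j then real (d i) else 0) :: real ^ 'n ^ 'n"
  show "0 < measure uniform_unit_sphere ?E"
  proof (rule measure_uniform_unit_sphere_pos [of "ball ?D (1/4)"])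
    fix A assume A: "A \<in> ball ?D (1/4)" "A \<noteq> 0"
    then have "d_real A = d_complex A"
      by (intro d_real_eq_d_complex_near_diagonal [OF d]) (simp add: dist_norm norm_minus_commute)
    then show "A /\<^sub>R norm A \<in> ?E"
      using A by (simp add: d_scaleR)
  qed (use E in auto)
  obtain e :: "3 \<Rightarrow> 'n" where "inj e"
    using card_le_inj [of "UNIV :: 3 set" "UNIV :: 'n set"] assms by auto
  then obtain B :: "real ^ 'n ^ 'n" where B: "d_complex B < d_real B"
    using block_d_complex_less_d_real d_complex_example3 d_real_example3 by (metis less_le_trans)
  \<comment> \<open>Strict inequality is an open condition that survives projection to the sphere,
    so its open set forces positive mass outside \<open>?E\<close>.\<close>
  have "0 < measure uniform_unit_sphere (- ?E)"
  proof (rule measure_uniform_unit_sphere_pos [of "{A. d_complex A < d_real A}"])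
    show "open {A :: real ^ 'n ^ 'n. d_complex A < d_real A}"
      by (intro open_Collect_less continuous_on_d)
    show "A /\<^sub>R norm A \<in> - ?E" if "A \<in> {A. d_complex A < d_real A}" "A \<noteq> 0" for A
      using that by (simp add: d_scaleR)
  qed (use B E in auto)
  also have "measure uniform_unit_sphere (- ?E) = 1 - measure uniform_unit_sphere ?E"
    using S.prob_compl [of ?E] E by (simp add: Compl_eq_Diff_UNIV)
  finally show "measure uniform_unit_sphere ?E < 1" by simp
qed

end
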